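(* Let $n\ge 1$, $a>0$, $\mu_1\ge 2$, $\mu_2\ge 0$, and let $V:\mathbb{R}^n\to\mathbb{R}$ be $V(q)=a|q|^{\mu_1}+\frac{\mu_2}{\mu_1}$. Let $h>\frac{\mu_2}{\mu_1}$. Then the following conditions hold: (1) $V(-q)=V(q)$ for all $q\in\mathbb{R}^n$; (2) there exist constants $m_1>0$, $m_2\ge 0$ (namely $m_1=\mu_1$, $m_2=\mu_2$) such that $V'(q)\cdot q\ge m_1V(q)-m_2$ for all $q\in\mathbb{R}^n$; (3) $V(q)\ge h$ for all $q$ with $|q|$ sufficiently large; (4) $3V'(q)\cdot q+V''(q)q\cdot q\ne 0$ for all $q\in\mathbb{R}^n\setminus\{0\}$. Moreover, the system $$\ddot q+V'(q)=0,\qquad \tfrac12|\dot q|^2+V(q)=h$$ has at least two non-constant periodic solutions $q:\mathbb{R}\to\mathbb{R}^n$.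
   Context: $V'$ denotes the gradient and $V''$ the Hessian of $V$; $\cdot$ is the Euclidean inner product on $\mathbb{R}^n$. *)

theory Defs
  imports "HOL-Analysis.Analysis"
begin

definition gradient :: "('a::real_inner \<Rightarrow> real) \<Rightarrow> 'a \<Rightarrow> 'a" where
  "gradient f x = (THE D. GDERIV f x :> D)"

text \<open>Both \<open>gradient\<close> and \<open>hessian\<close> are meaningful only where the derivatives exist;
  elsewhere their values are unspecified.\<close>

definition hessian :: "(real ^ 'n \<Rightarrow> real) \<Rightarrow> real ^ 'n \<Rightarrow> real ^ 'n ^ 'n" where
  "hessian f x = jacobian (gradient f) (at x)"

definition prescribed_energy_solution ::
    "('a::real_inner \<Rightarrow> real) \<Rightarrow> real \<Rightarrow> (real \<Rightarrow> 'a) \<Rightarrow> bool" where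
  "prescribed_energy_solution V h q \<longleftrightarrow>
     (\<exists>q' q''. \<forall>t. (q has_vector_derivative q' t) (at t) \<and>
                (q' has_vector_derivative q'' t) (at t) \<and>
                q'' t + gradient V (q t) = 0 \<and>
                1/2 * (norm (q' t))\<^sup>2 + V (q t) = h)"

definition periodic :: "(real \<Rightarrow> 'a) \<Rightarrow> bool" where
  "periodic q \<longleftrightarrow> (\<exists>T>0. \<forall>t. q (t + T) = q t)"

end

theory Submission
  imports Defs
begin

text \<open>
  Write \<open>p = \<mu>1\<close> for the exponent. The gradient is the radial field
  \<open>a p |q| powr (p - 2) q\<close>, which is homogeneous of degree \<open>p - 1\<close>. By Euler's identity its inner
  product with \<open>q\<close> is \<open>a p |q| powr p\<close>, so that (2) holds with equality, and the Hessian maps \<open>q\<close> to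
  \<open>p - 1\<close> times the gradient, so that the expression in (4) is \<open>(p + 2) a p |q| powr p > 0\<close>.
  The derivatives exist at the origin as well, because there \<open>a |q| powr p\<close> and, for \<open>p > 2\<close>,
  the gradient vanish to higher than first order; for \<open>p = 2\<close> the gradient is linear.

  Since the force is radial, motions along a line through the origin reduce to the scalar
  oscillator \<open>x'' = - a p |x| powr (p - 2) x\<close> with energy \<open>E = h - \<mu>2 / p > 0\<close>, in every dimension
  including one. If \<open>x\<close> is a non-constant periodic solution of it and \<open>e\<close> is a unit vector, then
  \<open>x e\<close> and \<open>- x e\<close> are the two solutions.

  The oscillator is solved by quadrature (\<open>power_law_oscillator\<close>). Integrating \<open>dt = dx / x'\<close>
  along the energy level is singular at the turning points \<open>x = \<plusminus>A\<close>, where \<open>a A powr p = E\<close>.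
  Substituting \<open>x = A sin \<phi>\<close> removes the singularity: energy conservation becomes
  \<open>\<phi>' = F \<phi>\<close>, where \<open>F y\<close> is a constant times
  \<open>sqrt ((1 - |sin y| powr p) / (1 - sin\<^sup>2 y))\<close>, a positive continuous function with period
  \<open>2 * pi\<close>. Such a first-order equation is solved by inverting an antiderivative of \<open>1 / F\<close>, and its
  solutions advance by \<open>2 * pi\<close> in a fixed time (\<open>periodic_autonomous_flow\<close>).
  The second-order equation follows from the conserved energy wherever \<open>x'\<close> is nonzero
  (\<open>DERIV_of_square\<close>) and from the value of \<open>F\<close> at the turning points otherwise
  (\<open>DERIV_mult_zero_continuous\<close>).
\<close>

section \<open>Powers of the norm\<close>

lemma has_derivative_zero_at_zero:
  fixes f :: "'a::real_normed_vector \<Rightarrow> 'b::real_normed_vector"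
  assumes "p > 0" and bound: "\<And>q. norm (f q) \<le> C * norm q powr p * norm q"
  shows "(f has_derivative (\<lambda>_. 0)) (at 0)"
proof -
  have f0: "f 0 = 0"
    using bound[of 0] by simp
  have "((\<lambda>q::'a. C * norm q powr p) \<longlongrightarrow> C * norm (0::'a) powr p) (at 0)"
    using \<open>p > 0\<close> by (intro tendsto_intros tendsto_powr2) auto
  then have lim: "((\<lambda>q::'a. C * norm q powr p) \<longlongrightarrow> 0) (at 0)"
    by simp
  have "((\<lambda>y. norm (f y) / norm y) \<longlongrightarrow> 0) (at 0)"
  proof (rule tendsto_sandwich[OF _ _ tendsto_const lim])
    show "\<forall>\<^sub>F y in at 0. norm (f y) / norm y \<le> C * norm y powr p"
      unfolding eventually_at_topological
      by (rule exI[of _ UNIV]) (use bound in \<open>auto simp: divide_le_eq\<close>)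
  qed auto
  then show ?thesis
    by (simp add: has_derivative_at f0)
qed

text \<open>The norm power is written as \<open>(q \<bullet> q) powr (p / 2)\<close>, a power of a smooth function that is
  positive away from the origin.\<close>

lemma has_derivative_norm_powr:
  fixes q :: "'a::real_inner"
  assumes "q \<noteq> 0"
  shows "((\<lambda>q. norm q powr p) has_derivative (\<lambda>k. p * norm q powr (p - 2) * (k \<bullet> q))) (at q)"
proof -
  have pos: "q \<bullet> q > 0"
    using assms by simp
  have eq: "norm y powr p = (y \<bullet> y) powr (p / 2)" for y :: 'a
    by (simp add: norm_eq_sqrt_inner powr_half_sqrt[symmetric] powr_powr)
  have eq': "norm q powr (p - 2) = (q \<bullet> q) powr (p / 2 - 1)"
    by (simp add: norm_eq_sqrt_inner powr_half_sqrt[symmetric] powr_powr diff_divide_distrib)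
  have "((\<lambda>s. s powr (p / 2)) has_real_derivative (p / 2) * (q \<bullet> q) powr (p / 2 - 1)) (at (q \<bullet> q))"
    using pos by (rule has_real_derivative_powr)
  moreover have "((\<lambda>y. y \<bullet> y) has_derivative (\<lambda>k. q \<bullet> k + k \<bullet> q)) (at q)"
    by (auto intro!: derivative_eq_intros)
  ultimately have "((\<lambda>y. (y \<bullet> y) powr (p / 2)) has_derivative
      (\<lambda>k. (q \<bullet> k + k \<bullet> q) * ((p / 2) * (q \<bullet> q) powr (p / 2 - 1)))) (at q)"
    by (rule DERIV_compose_FDERIV)
  then show ?thesis
    by (simp add: eq eq' inner_commute algebra_simps mult.commute)
qed

lemma GDERIV_norm_powr:
  fixes q :: "'a::real_inner"
  assumes "p > 1"
  shows "GDERIV (\<lambda>q. norm q powr p) q :> (p * norm q powr (p - 2)) *\<^sub>R q"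
proof (cases "q = 0")
  case True
  have "((\<lambda>q::'a. norm q powr p) has_derivative (\<lambda>_. 0)) (at 0)"
  proof (rule has_derivative_zero_at_zero[where p = "p - 1" and C = 1])
    show "norm (norm y powr p) \<le> 1 * norm y powr (p - 1) * norm y" for y :: 'a
      by (cases "y = 0") (simp_all add: powr_diff)
  qed (use assms in simp)
  with True show ?thesis
    by (simp add: gderiv_def)
next
  case False
  then show ?thesis
    using has_derivative_norm_powr[OF False, of p] by (simp add: gderiv_def)
qed

lemma norm_powr_inner_self: "norm q powr (p - 2) * (q \<bullet> q) = norm q powr p"
  for q :: "'a::real_inner"
  by (cases "q = 0") (simp_all add: powr_diff powr_numeral flip: power2_norm_eq_inner)

lemma has_derivative_norm_powr_scaleR:
  fixes q :: "'a::real_inner"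
  assumes "q \<noteq> 0"
  shows "((\<lambda>q. norm q powr p *\<^sub>R q) has_derivative
    (\<lambda>k. norm q powr p *\<^sub>R k + (p * norm q powr (p - 2) * (k \<bullet> q)) *\<^sub>R q)) (at q)"
  by (rule has_derivative_scaleR[OF has_derivative_norm_powr[OF assms] has_derivative_ident])

text \<open>For \<open>p = 0\<close> the convention \<open>0 powr 0 = 0\<close> does no harm at the origin, since the scalar is
  multiplied by the zero vector: the field is the identity.\<close>

lemma differentiable_norm_powr_scaleR:
  fixes q :: "'a::real_inner"
  assumes "p \<ge> 0"
  shows "(\<lambda>q. norm q powr p *\<^sub>R q) differentiable (at q)"
proof (cases "q = 0")
  case q: True
  show ?thesis
  proof (cases "p = 0")
    case True
    have "(\<lambda>q. norm q powr p *\<^sub>R q) = (\<lambda>q::'a. q)"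
      using True by (auto simp: fun_eq_iff)
    then show ?thesis
      by simp
  next
    case False
    have "((\<lambda>q::'a. norm q powr p *\<^sub>R q) has_derivative (\<lambda>_. 0)) (at 0)"
      by (rule has_derivative_zero_at_zero[where p = p and C = 1]) (use assms False in auto)
    with q show ?thesis
      by (auto simp: differentiable_def)
  qed
next
  case False
  then show ?thesis
    using has_derivative_norm_powr_scaleR differentiable_def by blast
qed

lemma gradient_eqI:
  assumes "GDERIV f x :> D"
  shows "gradient f x = D"
  unfolding gradient_def
proof (rule the_equality)
  fix D' assume "GDERIV f x :> D'"
  with assms have "(\<lambda>k. k \<bullet> D') = (\<lambda>k. k \<bullet> D)"
    unfolding gderiv_def by (rule has_derivative_unique[rotated])
  then have "\<forall>k. k \<bullet> D' = k \<bullet> D"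
    by (simp add: fun_eq_iff)
  then show "D' = D"
    by (simp only: vector_eq_ldot)
qed (fact assms)

section \<open>A periodic solution of the scalar oscillator\<close>

text \<open>Separation of variables. If \<open>G\<close> is an antiderivative of \<open>1 / F\<close>, then \<open>G\<close> is increasing, and
  the upper bound on \<open>F\<close> makes it grow at least linearly, hence surjective; its inverse solves the
  equation for all time. As \<open>G (y + P) - G y\<close> has derivative zero, it is a constant, which is the
  time needed to advance by \<open>P\<close>.\<close>

lemma periodic_autonomous_flow:
  fixes F :: "real \<Rightarrow> real"
  assumes cont: "continuous_on UNIV F" and pos: "\<And>y. F y > 0" and bound: "\<And>y. F y \<le> M"
    and per: "\<And>y. F (y + P) = F y" and "P > 0"
  obtains \<phi> T where "T > 0" "surj \<phi>" "\<And>t. (\<phi> has_real_derivative F (\<phi> t)) (at t)"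
    "\<And>t. \<phi> (t + T) = \<phi> t + P"
proof -
  have "\<exists>G. \<forall>y. -\<infinity> < ereal y \<longrightarrow> ereal y < \<infinity> \<longrightarrow>
      (G has_vector_derivative 1 / F y) (at y)"
    by (rule einterval_antiderivative)
      (use cont pos in \<open>auto intro!: continuous_intros
          simp: continuous_on_eq_continuous_at less_imp_neq[symmetric]\<close>)
  then obtain G where G: "\<And>y. (G has_real_derivative 1 / F y) (at y)"
    by (auto simp: has_real_derivative_iff_has_vector_derivative)
  have M: "M > 0"
    using pos[of 0] bound[of 0] by linarith
  have contG: "continuous_on S G" for S
    using G by (meson DERIV_isCont continuous_at_imp_continuous_on)
  have growth: "G z - G y \<ge> (z - y) / M" if "y \<le> z" for y z
  proof -
    have "\<exists>D. ((\<lambda>y. G y - y / M) has_real_derivative D) (at u) \<and> D \<ge> 0" for u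
      using G[of u] pos[of u] bound[of u] M
      by (intro exI[of _ "1 / F u - 1 / M"]) (auto intro!: derivative_eq_intros simp: frac_le)
    from DERIV_nonneg_imp_nondecreasing[OF that this] show ?thesis
      by (simp add: diff_divide_distrib)
  qed
  have G_inj: "inj G"
  proof (rule linorder_injI)
    fix y z :: real assume "y < z"
    with M have "(z - y) / M > 0" by simp
    with growth[of y z] \<open>y < z\<close> show "G y \<noteq> G z" by linarith
  qed
  have G_surj: "surj G"
  proof (rule surjI[of G "\<lambda>t. SOME y. G y = t"])
    fix t
    define r where "r = M * \<bar>t - G 0\<bar>"
    have r: "r \<ge> 0" "r / M = \<bar>t - G 0\<bar>"
      using M by (auto simp: r_def)
    have "G (- r) \<le> t" "t \<le> G r"
      using growth[of "-r" 0] growth[of 0 r] r by auto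
    then have "\<exists>y\<ge>-r. y \<le> r \<and> G y = t"
      using r by (intro IVT' contG) auto
    then show "G (SOME y. G y = t) = t"
      by (auto intro: someI_ex)
  qed
  define \<phi> where "\<phi> = inv G"
  have G\<phi>: "G (\<phi> t) = t" and \<phi>G: "\<phi> (G y) = y" for t y
    using G_inj G_surj by (auto simp: \<phi>_def surj_f_inv_f)
  have "isCont \<phi> (G y)" for y
    by (rule isCont_inverse_function[of 1 y \<phi> G])
      (use \<phi>G DERIV_isCont[OF G] in auto)
  then have \<phi>_cont: "isCont \<phi> t" for t
    using G\<phi>[of t] by metis
  have deriv: "(\<phi> has_real_derivative F (\<phi> t)) (at t)" for t
  proof -
    have "(\<phi> has_real_derivative inverse (1 / F (\<phi> t))) (at t)"
    proof (rule DERIV_inverse_function[where f = G and a = "t - 1" and b = "t + 1"])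
      show "(G has_real_derivative 1 / F (\<phi> t)) (at (\<phi> t))"
        by (rule G)
      show "1 / F (\<phi> t) \<noteq> 0"
        using pos[of "\<phi> t"] by simp
    qed (simp_all add: G\<phi> \<phi>_cont)
    then show ?thesis by simp
  qed
  define T where "T = G P - G 0"
  have "T > 0"
    using growth[of 0 P, simplified] \<open>P > 0\<close> divide_pos_pos[OF \<open>P > 0\<close> M] unfolding T_def by linarith
  have shift: "G (y + P) = G y + T" for y
  proof -
    have "((\<lambda>y. G (y + P) - G y) has_real_derivative 0) (at u)" for u
    proof -
      have "((\<lambda>y. G (y + P)) has_real_derivative 1 / F (u + P)) (at u)"
        using G[of "u + P"] by (simp add: DERIV_shift)
      from DERIV_diff[OF this G[of u]] show ?thesis
        by (simp add: per)
    qed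
    then have "G (y + P) - G y = G (0 + P) - G 0"
      by (intro DERIV_isconst_all[of "\<lambda>y. G (y + P) - G y"] allI)
    then show ?thesis by (simp add: T_def)
  qed
  have "surj \<phi>"
    by (rule surjI) (rule \<phi>G)
  moreover have "\<phi> (t + T) = \<phi> t + P" for t
    using \<phi>G[of "\<phi> t + P"] by (simp add: shift G\<phi>)
  ultimately show thesis
    using \<open>T > 0\<close> deriv by (intro that[of T \<phi>])
qed

text \<open>Continuity fixes the sign of \<open>v\<close> near \<open>t\<close>, so the square can be undone: the difference quotient
  of \<open>v\<close> is that of its square divided by \<open>v s + v t\<close>.\<close>

lemma DERIV_of_square:
  fixes v :: "real \<Rightarrow> real"
  assumes "((\<lambda>t. (v t)\<^sup>2) has_real_derivative 2 * v t * D) (at t)"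
    and cont: "isCont v t" and nz: "v t \<noteq> 0"
  shows "(v has_real_derivative D) (at t)"
proof -
  have sum: "((\<lambda>s. v s + v t) \<longlongrightarrow> v t + v t) (at t)"
    using cont by (intro tendsto_add tendsto_const) (simp add: isCont_def)
  have "((\<lambda>s. ((v s)\<^sup>2 - (v t)\<^sup>2) / (s - t) / (v s + v t)) \<longlongrightarrow> 2 * v t * D / (v t + v t)) (at t)"
    using assms(1) sum nz by (intro tendsto_divide) (auto simp: has_field_derivative_iff)
  moreover have "\<forall>\<^sub>F s in at t. ((v s)\<^sup>2 - (v t)\<^sup>2) / (s - t) / (v s + v t) = (v s - v t) / (s - t)"
  proof -
    have "\<forall>\<^sub>F s in at t. v s + v t \<noteq> 0"
      using nz by (intro tendsto_imp_eventually_ne[OF sum]) simp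
    then show ?thesis
      by eventually_elim (simp add: power2_eq_square square_diff_square_factored)
  qed
  ultimately have "((\<lambda>s. (v s - v t) / (s - t)) \<longlongrightarrow> 2 * v t * D / (v t + v t)) (at t)"
    by (rule Lim_transform_eventually)
  then show ?thesis
    using nz by (simp add: has_field_derivative_iff)
qed

text \<open>At a zero of \<open>f\<close> the product rule needs only continuity of the other factor. This applies at a
  turning point, where the velocity is \<open>A cos \<phi>\<close>, which vanishes, times the angular speed, which
  is known to be continuous.\<close>

lemma DERIV_mult_zero_continuous:
  fixes f g :: "real \<Rightarrow> real"
  assumes f: "(f has_real_derivative D) (at t)" and f0: "f t = 0" and g: "isCont g t"
  shows "((\<lambda>s. f s * g s) has_real_derivative D * g t) (at t)"
proof -
  have "((\<lambda>s. (f s - f t) / (s - t) * g s) \<longlongrightarrow> D * g t) (at t)"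
    using f g by (intro tendsto_mult) (auto simp: has_field_derivative_iff isCont_def)
  then show ?thesis
    by (simp add: has_field_derivative_iff f0)
qed

text \<open>The value at \<open>1\<close> is the derivative of \<open>s powr r\<close> there, which makes the difference quotient
  continuous up to the turning point, where \<open>s = sin\<^sup>2 \<phi>\<close> equals \<open>1\<close>.\<close>

definition powr_quotient :: "real \<Rightarrow> real \<Rightarrow> real" where
  "powr_quotient r s = (if s = 1 then r else (1 - s powr r) / (1 - s))"

lemma powr_quotient_mult: "(1 - s) * powr_quotient r s = 1 - s powr r"
  by (simp add: powr_quotient_def)

lemma continuous_on_powr_quotient:
  assumes "r > 0"
  shows "continuous_on {0..1} (powr_quotient r)"
  unfolding continuous_on_eq_continuous_within
proof
  fix s :: real assume s: "s \<in> {0..1}"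
  show "continuous (at s within {0..1}) (powr_quotient r)"
  proof (cases "s = 1")
    case True
    have "((\<lambda>s. s powr r) has_real_derivative r * 1 powr (r - 1)) (at 1)"
      by (rule has_real_derivative_powr) simp
    then have "((\<lambda>s. (s powr r - 1) / (s - 1)) \<longlongrightarrow> r) (at 1)"
      by (simp add: has_field_derivative_iff)
    then have "(powr_quotient r \<longlongrightarrow> r) (at 1)"
    proof (rule Lim_transform_eventually)
      show "\<forall>\<^sub>F s in at 1. (s powr r - 1) / (s - 1) = powr_quotient r s"
        unfolding eventually_at_filter powr_quotient_def
        by (intro always_eventually) (auto simp: divide_simps, simp add: algebra_simps)
    qed
    then show ?thesis
      using True by (simp add: continuous_within powr_quotient_def tendsto_within_subset[of _ _ 1 UNIV])
  next
    case False
    with s have "s < 1" by simp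
    have "continuous (at s within {0..1}) (\<lambda>s. (1 - s powr r) / (1 - s))"
    proof -
      have "continuous_on {0..<1} (\<lambda>s. (1 - s powr r) / (1 - s))"
        using assms by (intro continuous_intros continuous_on_powr') auto
      then have "continuous (at s within {0..<1}) (\<lambda>s. (1 - s powr r) / (1 - s))"
        using s \<open>s < 1\<close> by (simp add: continuous_on_eq_continuous_within)
      moreover have "at s within {0..<1} = at s within {0..1}"
        by (rule at_within_nhd[of _ "{..<1}"]) (use \<open>s < 1\<close> in auto)
      ultimately show ?thesis by simp
    qed
    then show ?thesis
    proof (rule continuous_transform_within[where \<delta> = "1 - s"])
      show "(1 - y powr r) / (1 - y) = powr_quotient r y" if "dist y s < 1 - s" for y
        using that by (auto simp: powr_quotient_def dist_real_def)
    qed (use s \<open>s < 1\<close> in auto)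
  qed
qed

lemma powr_quotient_ge_1:
  assumes "r \<ge> 1" "0 \<le> s" "s \<le> 1"
  shows "powr_quotient r s \<ge> 1"
proof (cases "s = 1")
  case False
  have "s powr r \<le> s powr 1"
    using assms by (intro powr_mono') auto
  with assms False show ?thesis
    by (simp add: powr_quotient_def le_divide_eq)
qed (use assms in \<open>simp add: powr_quotient_def\<close>)

text \<open>The amplitude \<open>A\<close> is where the potential energy equals \<open>E\<close>, and \<open>c\<close> is chosen so that
  \<open>A c = sqrt (2 E)\<close> is the speed at the origin. With \<open>x = A sin \<phi>\<close> and \<open>\<phi>' = F \<phi>\<close> the energy
  identity \<open>v\<^sup>2 = 2 (E - a |x| powr p)\<close> is then the defining property of \<open>powr_quotient\<close> at
  \<open>sin\<^sup>2 \<phi>\<close>.\<close>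

lemma power_law_oscillator:
  fixes a p E :: real
  assumes a: "a > 0" and p: "p \<ge> 2" and E: "E > 0"
  obtains x v :: "real \<Rightarrow> real" and T :: real where "T > 0"
    "\<And>t. (x has_real_derivative v t) (at t)"
    "\<And>t. (v has_real_derivative - (a * p * \<bar>x t\<bar> powr (p - 2) * x t)) (at t)"
    "\<And>t. (v t)\<^sup>2 / 2 + a * \<bar>x t\<bar> powr p = E"
    "\<And>t. x (t + T) = x t"
    "\<not> x constant_on UNIV"
proof -
  define A where "A = (E / a) powr (1 / p)"
  have A: "A > 0" "a * A powr p = E"
    using a p E by (auto simp: A_def powr_powr)
  define g where "g y = powr_quotient (p / 2) ((sin y)\<^sup>2)" for y
  have sin_powr: "((sin y)\<^sup>2) powr (p / 2) = \<bar>sin y\<bar> powr p" for y :: real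
  proof -
    have "(sin y)\<^sup>2 = \<bar>sin y\<bar> powr 2"
      by (cases "sin y = 0") (auto simp: powr_numeral)
    then show ?thesis by (simp only: powr_powr) simp
  qed
  have sin01: "(sin y)\<^sup>2 \<in> {0..1}" for y :: real
    by (simp add: abs_square_le_1)
  have g_mult: "(cos y)\<^sup>2 * g y = 1 - \<bar>sin y\<bar> powr p" for y
    using powr_quotient_mult[of "(sin y)\<^sup>2" "p / 2"]
    by (simp add: g_def sin_powr cos_squared_eq)
  have g_turn: "g y = p / 2" if "cos y = 0" for y
    using that sin_cos_squared_add[of y] by (simp add: g_def powr_quotient_def)
  have g_ge: "g y \<ge> 1" for y
    unfolding g_def using sin01[of y] p by (intro powr_quotient_ge_1) auto
  have cont_q: "continuous_on {0..1} (powr_quotient (p / 2))"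
    using p by (intro continuous_on_powr_quotient) auto
  have g_cont: "continuous_on UNIV g"
    unfolding g_def by (rule continuous_on_compose2[OF cont_q])
      (use sin01 in \<open>auto intro!: continuous_intros\<close>)
  obtain B where B: "\<And>s. s \<in> {0..1} \<Longrightarrow> powr_quotient (p / 2) s \<le> B"
    using continuous_attains_sup[OF _ _ cont_q] by fastforce
  define c where "c = sqrt (2 * E) / A"
  have c: "c > 0" "c\<^sup>2 * A\<^sup>2 = 2 * E"
    using A E by (auto simp: c_def power_divide)
  define F where "F y = c * sqrt (g y)" for y
  have F_sq: "(F y)\<^sup>2 = c\<^sup>2 * g y" for y
    using g_ge[of y] by (simp add: F_def power_mult_distrib)
  have F_cont: "continuous_on UNIV F"
    unfolding F_def by (intro continuous_intros g_cont)
  obtain \<phi> T where T: "T > 0" and surj: "surj \<phi>"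
    and \<phi>: "\<And>t. (\<phi> has_real_derivative F (\<phi> t)) (at t)"
    and \<phi>_per: "\<And>t. \<phi> (t + T) = \<phi> t + 2 * pi"
  proof (rule periodic_autonomous_flow[of F "c * sqrt B" "2 * pi"])
    show "F y > 0" for y
      using c g_ge[of y] by (auto simp: F_def)
    show "F y \<le> c * sqrt B" for y
      using c B[OF sin01[of y]] by (auto simp: F_def g_def)
    show "F (y + 2 * pi) = F y" for y
      by (simp add: F_def g_def)
  qed (use F_cont in auto)
  define x where "x t = A * sin (\<phi> t)" for t
  define v where "v t = A * cos (\<phi> t) * F (\<phi> t)" for t
  have x_powr: "a * \<bar>x t\<bar> powr p = E * \<bar>sin (\<phi> t)\<bar> powr p" for t
    using A by (simp add: x_def abs_mult powr_mult)
  have energy: "(v t)\<^sup>2 = 2 * (E - a * \<bar>x t\<bar> powr p)" for t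
  proof -
    have "(v t)\<^sup>2 = (c\<^sup>2 * A\<^sup>2) * ((cos (\<phi> t))\<^sup>2 * g (\<phi> t))"
      by (simp add: v_def power_mult_distrib F_sq)
    also have "\<dots> = 2 * (E - a * \<bar>x t\<bar> powr p)"
      unfolding c(2) g_mult x_powr by (simp add: algebra_simps)
    finally show ?thesis .
  qed
  have x': "(x has_real_derivative v t) (at t)" for t
    unfolding x_def v_def using \<phi>[of t] by (auto intro!: derivative_eq_intros)
  have F\<phi>_cont: "isCont (\<lambda>t. F (\<phi> t)) t" for t
    by (rule isCont_o2[OF DERIV_isCont[OF \<phi>]])
      (use F_cont in \<open>simp add: continuous_on_eq_continuous_at\<close>)
  \<comment> \<open>Differentiating the energy identity yields \<open>v\<close> times the equation of motion, which is
    inconclusive exactly at the turning points \<open>cos \<phi> = 0\<close>. There \<open>A cos \<phi>\<close> vanishes, and the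
    derivative of \<open>v\<close> is \<open>- A sin \<phi> F\<^sup>2\<close> with \<open>F\<^sup>2 = c\<^sup>2 p / 2\<close>.\<close>
  have v': "(v has_real_derivative - (a * p * \<bar>x t\<bar> powr (p - 2) * x t)) (at t)" for t
  proof (cases "cos (\<phi> t) = 0")
    case False
    have "F (\<phi> t) \<noteq> 0"
      using c g_ge[of "\<phi> t"] by (auto simp: F_def)
    with False A have nz: "v t \<noteq> 0"
      by (simp add: v_def)
    have cont: "isCont v t"
      unfolding v_def using DERIV_isCont[OF \<phi>, of t] F\<phi>_cont[of t] by (intro continuous_intros) auto
    have "((\<lambda>x. \<bar>x\<bar> powr p) has_real_derivative p * \<bar>x t\<bar> powr (p - 2) * x t) (at (x t))"
      using GDERIV_norm_powr[of p "x t"] p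
      by (simp add: gderiv_def has_field_derivative_def mult_ac)
    from DERIV_cmult[OF DERIV_diff[OF DERIV_const DERIV_cmult[OF DERIV_chain2[OF this x'[of t]]]]]
    have "((\<lambda>t. 2 * (E - a * \<bar>x t\<bar> powr p)) has_real_derivative
        2 * (0 - a * (p * \<bar>x t\<bar> powr (p - 2) * x t * v t))) (at t)" .
    then have "((\<lambda>t. (v t)\<^sup>2) has_real_derivative
        2 * v t * (- (a * p * \<bar>x t\<bar> powr (p - 2) * x t))) (at t)"
      unfolding energy by (simp add: mult_ac)
    then show ?thesis
      using cont nz by (rule DERIV_of_square)
  next
    case True
    have sin1: "\<bar>sin (\<phi> t)\<bar> = 1"
      using True sin_cos_squared_add[of "\<phi> t"] by (auto simp: power2_eq_1_iff)
    have "((\<lambda>t. A * cos (\<phi> t)) has_real_derivative - A * sin (\<phi> t) * F (\<phi> t)) (at t)"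
      using \<phi>[of t] by (auto intro!: derivative_eq_intros)
    then have "(v has_real_derivative - A * sin (\<phi> t) * F (\<phi> t) * F (\<phi> t)) (at t)"
      unfolding v_def using True F\<phi>_cont by (intro DERIV_mult_zero_continuous) auto
    moreover have "- A * sin (\<phi> t) * F (\<phi> t) * F (\<phi> t) = - (a * p * \<bar>x t\<bar> powr (p - 2) * x t)"
    proof -
      have "F (\<phi> t) * F (\<phi> t) * A\<^sup>2 = a * p * A powr p"
      proof -
        have "F (\<phi> t) * F (\<phi> t) * A\<^sup>2 = (c\<^sup>2 * A\<^sup>2) * (p / 2)"
          using F_sq[of "\<phi> t"] by (simp add: power2_eq_square g_turn[OF True])
        then show ?thesis
          by (simp add: c(2) A(2)[symmetric])
      qed
      moreover have "A powr p = A powr (p - 2) * A\<^sup>2"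
        using A(1) by (simp add: powr_diff powr_numeral)
      ultimately have "F (\<phi> t) * F (\<phi> t) = a * p * A powr (p - 2)"
        using A(1) by simp
      moreover have "\<bar>x t\<bar> = A"
        using A(1) sin1 by (simp add: x_def abs_mult)
      ultimately show ?thesis
        by (simp add: x_def mult.assoc mult.left_commute)
    qed
    ultimately show ?thesis by simp
  qed
  have nonconst: "\<not> x constant_on UNIV"
  proof
    assume "x constant_on UNIV"
    moreover obtain s0 s1 where "\<phi> s0 = 0" "\<phi> s1 = pi / 2"
      using surj by (metis surjD)
    then have "x s0 = 0" "x s1 = A"
      by (simp_all only: x_def sin_zero sin_pi_half mult_zero_right mult_1_right)
    ultimately have "A = 0"
      by (auto simp: constant_on_def)
    with A(1) show False
      by simp
  qed
  have energy': "(v t)\<^sup>2 / 2 + a * \<bar>x t\<bar> powr p = E" for t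
    unfolding energy by (simp add: field_simps)
  have x_per: "x (t + T) = x t" for t
    by (simp add: x_def \<phi>_per)
  show thesis
    by (rule that[OF T x' v' energy' x_per nonconst])
qed

section \<open>The power-law potential\<close>

theorem mainTheorem2:
  fixes a \<mu>1 \<mu>2 h :: real and V :: "real ^ 'n \<Rightarrow> real"
  assumes "a > 0" and "\<mu>1 \<ge> 2" and "\<mu>2 \<ge> 0"
    and V_eq: "\<And>q. V q = a * norm q powr \<mu>1 + \<mu>2 / \<mu>1"
    and "h > \<mu>2 / \<mu>1"
  shows
    \<comment> \<open>\<open>V\<close> is twice differentiable, so that the values of \<open>gradient\<close> and \<open>hessian\<close> below
        are genuine\<close>
    "(\<forall>q. V differentiable (at q) \<and> gradient V differentiable (at q)) \<and>
     (\<forall>q. V (- q) = V q) \<and>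
     (\<exists>m1 m2. m1 > 0 \<and> m2 \<ge> 0 \<and> m1 = \<mu>1 \<and> m2 = \<mu>2 \<and>
        (\<forall>q. gradient V q \<bullet> q \<ge> m1 * V q - m2)) \<and>
     (\<exists>R. \<forall>q. norm q \<ge> R \<longrightarrow> V q \<ge> h) \<and>
     (\<forall>q. q \<noteq> 0 \<longrightarrow> 3 * (gradient V q \<bullet> q) + (hessian V q *v q) \<bullet> q \<noteq> 0) \<and>
     (\<exists>q1 q2. q1 \<noteq> q2 \<and>
        prescribed_energy_solution V h q1 \<and> periodic q1 \<and> \<not> q1 constant_on UNIV \<and>
        prescribed_energy_solution V h q2 \<and> periodic q2 \<and> \<not> q2 constant_on UNIV)"
proof -
  note a = \<open>a > 0\<close> and \<mu> = \<open>\<mu>1 \<ge> 2\<close>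
  have V: "V = (\<lambda>q. a * norm q powr \<mu>1 + \<mu>2 / \<mu>1)"
    using V_eq by blast
  have GD: "GDERIV V q :> (a * \<mu>1) *\<^sub>R (norm q powr (\<mu>1 - 2) *\<^sub>R q)" for q
  proof -
    have "((\<lambda>q. norm q powr \<mu>1) has_derivative
        (\<lambda>k. k \<bullet> ((\<mu>1 * norm q powr (\<mu>1 - 2)) *\<^sub>R q))) (at q)"
      using GDERIV_norm_powr[of \<mu>1 q] \<mu> unfolding gderiv_def by simp
    from has_derivative_add_const[OF has_derivative_mult_right[OF this, of a], of "\<mu>2 / \<mu>1"]
    show ?thesis
      by (simp add: gderiv_def V mult_ac)
  qed
  then have grad: "gradient V q = (a * \<mu>1) *\<^sub>R (norm q powr (\<mu>1 - 2) *\<^sub>R q)" for q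
    by (rule gradient_eqI)
  then have grad_fun: "gradient V = (\<lambda>q. (a * \<mu>1) *\<^sub>R (norm q powr (\<mu>1 - 2) *\<^sub>R q))"
    by blast
  have V_diff: "V differentiable (at q)" for q
    using GD[of q] by (auto simp: gderiv_def differentiable_def)
  have grad_diff: "gradient V differentiable (at q)" for q
    unfolding grad_fun using \<mu>
    by (intro differentiable_scaleR differentiable_const differentiable_norm_powr_scaleR) simp
  have grad_inner: "gradient V q \<bullet> q = a * \<mu>1 * norm q powr \<mu>1" for q
    using norm_powr_inner_self[of q \<mu>1] by (simp add: grad mult.assoc)
  have hess: "hessian V q *v q = (\<mu>1 - 1) *\<^sub>R gradient V q" if "q \<noteq> 0" for q
  proof -
    have "(gradient V has_derivative (\<lambda>k. hessian V q *v k)) (at q)"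
      using grad_diff[of q] jacobian_works unfolding hessian_def by blast
    moreover have "(gradient V has_derivative (\<lambda>k. (a * \<mu>1) *\<^sub>R (norm q powr (\<mu>1 - 2) *\<^sub>R k
        + ((\<mu>1 - 2) * norm q powr (\<mu>1 - 2 - 2) * (k \<bullet> q)) *\<^sub>R q))) (at q)"
      unfolding grad_fun
      by (rule has_derivative_scaleR_right[OF has_derivative_norm_powr_scaleR[OF that]])
    ultimately have "hessian V q *v q = (a * \<mu>1) *\<^sub>R (norm q powr (\<mu>1 - 2) *\<^sub>R q
        + ((\<mu>1 - 2) * norm q powr (\<mu>1 - 2 - 2) * (q \<bullet> q)) *\<^sub>R q)"
      by (rule fun_cong[OF has_derivative_unique])
    also have "\<dots> = (a * \<mu>1) *\<^sub>R (norm q powr (\<mu>1 - 2) *\<^sub>R q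
        + ((\<mu>1 - 2) * norm q powr (\<mu>1 - 2)) *\<^sub>R q)"
      by (simp only: mult.assoc norm_powr_inner_self)
    also have "\<dots> = (\<mu>1 - 1) *\<^sub>R gradient V q"
    proof -
      have "norm q powr (\<mu>1 - 2) + (\<mu>1 - 2) * norm q powr (\<mu>1 - 2)
          = (\<mu>1 - 1) * norm q powr (\<mu>1 - 2)"
        by (simp add: left_diff_distrib)
      then show ?thesis
        unfolding grad scaleR_left_distrib[symmetric] by (simp add: mult_ac)
    qed
    finally show ?thesis .
  qed
  have coercive: "V q \<ge> h" if "norm q \<ge> (h / a) powr (1 / \<mu>1)" for q
  proof -
    have "h > 0"
      using \<open>h > \<mu>2 / \<mu>1\<close> \<open>\<mu>2 \<ge> 0\<close> \<mu> divide_nonneg_nonneg[of \<mu>2 \<mu>1] by linarith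
    have "h / a = ((h / a) powr (1 / \<mu>1)) powr \<mu>1"
      using \<open>h > 0\<close> a \<mu> by (simp add: powr_powr)
    also have "\<dots> \<le> norm q powr \<mu>1"
      using that \<mu> by (intro powr_mono2) auto
    finally have "h \<le> a * norm q powr \<mu>1"
      using a by (simp add: field_simps)
    then show ?thesis
      unfolding V_eq using \<open>\<mu>2 \<ge> 0\<close> \<mu> divide_nonneg_nonneg[of \<mu>2 \<mu>1] by linarith
  qed
  have nondeg: "3 * (gradient V q \<bullet> q) + (hessian V q *v q) \<bullet> q \<noteq> 0" if "q \<noteq> 0" for q
  proof -
    have "gradient V q \<bullet> q > 0"
      using that a \<mu> by (simp add: grad_inner)
    then have "(\<mu>1 + 2) * (gradient V q \<bullet> q) > 0"
      using \<mu> by simp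
    moreover have "3 * (gradient V q \<bullet> q) + (hessian V q *v q) \<bullet> q = (\<mu>1 + 2) * (gradient V q \<bullet> q)"
      unfolding hess[OF that] inner_scaleR_left by (simp add: ring_distribs)
    ultimately show ?thesis
      by linarith
  qed
  have E: "h - \<mu>2 / \<mu>1 > 0"
    using \<open>h > \<mu>2 / \<mu>1\<close> by simp
  obtain x v T where T: "T > 0"
    and x': "\<And>t. (x has_real_derivative v t) (at t)"
    and v': "\<And>t. (v has_real_derivative - (a * \<mu>1 * \<bar>x t\<bar> powr (\<mu>1 - 2) * x t)) (at t)"
    and energy: "\<And>t. (v t)\<^sup>2 / 2 + a * \<bar>x t\<bar> powr \<mu>1 = h - \<mu>2 / \<mu>1"
    and per: "\<And>t. x (t + T) = x t" and nonconst: "\<not> x constant_on UNIV"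
    by (rule power_law_oscillator[OF a \<mu> E]) (rule that)
  have sol: "prescribed_energy_solution V h (\<lambda>t. x t *\<^sub>R e)" if "norm e = 1" for e :: "real ^ 'n"
    unfolding prescribed_energy_solution_def
  proof (intro exI allI conjI)
    fix t
    show "((\<lambda>t. x t *\<^sub>R e) has_vector_derivative v t *\<^sub>R e) (at t)"
      using x'[of t] by (auto intro!: derivative_eq_intros)
    show "((\<lambda>t. v t *\<^sub>R e) has_vector_derivative
        (- (a * \<mu>1 * \<bar>x t\<bar> powr (\<mu>1 - 2) * x t)) *\<^sub>R e) (at t)"
      using v'[of t] by (auto intro!: derivative_eq_intros)
    show "(- (a * \<mu>1 * \<bar>x t\<bar> powr (\<mu>1 - 2) * x t)) *\<^sub>R e + gradient V (x t *\<^sub>R e) = 0"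
      using that by (simp add: grad mult.assoc)
    show "1/2 * (norm (v t *\<^sub>R e))\<^sup>2 + V (x t *\<^sub>R e) = h"
      using that energy[of t] by (simp add: V_eq)
  qed
  have period: "periodic (\<lambda>t. x t *\<^sub>R e)" for e :: "real ^ 'n"
    unfolding periodic_def using T by (intro exI[of _ T]) (simp add: per)
  have nonconst': "\<not> (\<lambda>t. x t *\<^sub>R e) constant_on UNIV" if "norm e = 1" for e :: "real ^ 'n"
  proof
    assume "(\<lambda>t. x t *\<^sub>R e) constant_on UNIV"
    then have "x s *\<^sub>R e = x 0 *\<^sub>R e" for s
      unfolding constant_on_def by (metis UNIV_I)
    moreover have "e \<noteq> 0"
      using that by auto
    ultimately have "x s = x 0" for s
      unfolding scaleR_cancel_right by blast
    then have "x constant_on UNIV"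
      unfolding constant_on_def by blast
    with nonconst show False by blast
  qed
  obtain e :: "real ^ 'n" where e: "norm e = 1"
    by (rule that[OF norm_axis_1])
  then have e': "norm (- e) = 1"
    by simp
  have distinct: "(\<lambda>t. x t *\<^sub>R e) \<noteq> (\<lambda>t. x t *\<^sub>R (- e))"
  proof
    assume eq: "(\<lambda>t. x t *\<^sub>R e) = (\<lambda>t. x t *\<^sub>R (- e))"
    have "x t = 0" for t
    proof -
      have "x t *\<^sub>R e = (- x t) *\<^sub>R e"
        using fun_cong[OF eq, of t] by simp
      moreover have "e \<noteq> 0"
        using e by auto
      ultimately have "x t = - x t"
        unfolding scaleR_cancel_right by blast
      then show ?thesis by linarith
    qed
    then have "x constant_on UNIV"
      unfolding constant_on_def by blast
    with nonconst show False by blast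
  qed
  have two: "\<exists>q1 q2. q1 \<noteq> q2 \<and>
        prescribed_energy_solution V h q1 \<and> periodic q1 \<and> \<not> q1 constant_on UNIV \<and>
        prescribed_energy_solution V h q2 \<and> periodic q2 \<and> \<not> q2 constant_on UNIV"
    by (intro exI conjI)
      (rule distinct sol[OF e] sol[OF e'] period nonconst'[OF e] nonconst'[OF e'])+
  have euler: "gradient V q \<bullet> q = \<mu>1 * V q - \<mu>2" for q
    unfolding grad_inner V_eq using \<mu> by (simp add: distrib_left)
  have superquadratic: "\<exists>m1 m2. m1 > 0 \<and> m2 \<ge> 0 \<and> m1 = \<mu>1 \<and> m2 = \<mu>2 \<and>
        (\<forall>q. gradient V q \<bullet> q \<ge> m1 * V q - m2)"
    using \<mu> \<open>\<mu>2 \<ge> 0\<close> by (intro exI[of _ \<mu>1] exI[of _ \<mu>2]) (simp add: euler)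
  have coercive': "\<exists>R. \<forall>q. norm q \<ge> R \<longrightarrow> V q \<ge> h"
    using coercive by blast
  have even: "V (- q) = V q" for q
    by (simp add: V_eq)
  show ?thesis
    by (intro conjI allI impI V_diff grad_diff even superquadratic coercive' nondeg two)
qed

end
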